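(* Let $V$ be a real vector space of finite dimension $n\ge 1$ and let $P\subset V$ be a compact convex polytope with non-empty interior which is described as $$P=\{x\in V: f_1(x)\ge 0,\ldots,f_m(x)\ge 0\},$$ where $f_1,\ldots,f_m:V\to\mathbb{R}$ are non-constant affine functions. Let $d$ be the Hilbert metric on $\operatorname{int}P$ and endow the dual space $V^*$ with some norm. Then the map $$\Phi:(\operatorname{int}P,d)\to V^*,\qquad x\mapsto\sum_{i=1}^m \log f_i(x)\,df_i$$ is a bilipschitz diffeomorphism (onto $V^*$).
   Context: For an affine function $f$ on $V$, $df\in V^*$ denotes its differential, i.e. its linear part. Hilbert metric: for $x\ne y$ in $\operatorname{int}P$, let $a_1,a_2$ be the two intersection points of the line through $x$ and $y$ with $\partial P$, labelled so that $a_1,x,y,a_2$ lie in this order on the line. Then $$d(x,y):=\frac12\log\left(\frac{\|y-a_1\|_2}{\|x-a_1\|_2}\cdot\frac{\|x-a_2\|_2}{\|y-a_2\|_2}\right)$$ (one half of the absolute value of the logarithm of the cross-ratio $[a_1,a_2,x,y]$; this does not depend on the choice of the Euclidean norm $\|\cdot\|_2$ on $V$), and $d(x,x):=0$. Bilipschitz means that there is a constant $L\ge1$ with $L^{-1}d(x,y)\le\|\Phi(x)-\Phi(y)\|\le L\,d(x,y)$ for all $x,y\in\operatorname{int}P$, where $\|\cdot\|$ is the chosen norm on $V^*$. *)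

theory Defs
  imports "HOL-Analysis.Analysis"
begin

definition affine_function :: "('a::real_vector \<Rightarrow> real) \<Rightarrow> bool" where
  "affine_function f \<longleftrightarrow> (\<exists>l c. linear l \<and> f = (\<lambda>x. l x + c))"

text \<open>The dual space of \<open>'a\<close> is \<open>'a \<Rightarrow>\<^sub>L real\<close>: in finite dimension every linear functional is bounded.
  The linear part of an affine function \<open>f\<close> is \<open>v \<mapsto> f v - f 0\<close>; on other functions the
  value below has no meaning.\<close>

definition differential :: "('a::euclidean_space \<Rightarrow> real) \<Rightarrow> ('a \<Rightarrow>\<^sub>L real)" where
  "differential f = Blinfun (\<lambda>v. f v - f 0)"

lemma differential_apply:
  assumes "affine_function f"
  shows "blinfun_apply (differential f) v = f v - f 0"
proof -
  obtain l c where l: "linear l" and f: "f = (\<lambda>x. l x + c)"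
    using assms unfolding affine_function_def by blast
  have eq: "(\<lambda>v. f v - f 0) = l"
    using l by (simp add: f linear_0)
  have "bounded_linear l"
    using l by (simp add: linear_conv_bounded_linear)
  then have "blinfun_apply (differential f) = (\<lambda>v. f v - f 0)"
    unfolding differential_def eq by (rule bounded_linear_Blinfun_apply)
  then show ?thesis
    by simp
qed

text \<open>The pair of points in which the line through \<open>x\<close> and \<open>y\<close> meets the boundary of \<open>P\<close>,
  in the order \<open>a\<^sub>1, x, y, a\<^sub>2\<close>. By \<open>hilbert_chord_unique\<close> it exists and is
  unique if \<open>P\<close> is a convex body and \<open>x \<noteq> y\<close> are interior points.\<close>

definition is_hilbert_chord :: "'a::euclidean_space set \<Rightarrow> 'a \<Rightarrow> 'a \<Rightarrow> 'a \<times> 'a \<Rightarrow> bool" where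
  "is_hilbert_chord P x y = (\<lambda>(a\<^sub>1, a\<^sub>2).
     frontier P \<inter> affine hull {x, y} = {a\<^sub>1, a\<^sub>2} \<and> between (a\<^sub>1, y) x \<and> between (x, a\<^sub>2) y)"

definition hilbert_dist :: "'a::euclidean_space set \<Rightarrow> 'a \<Rightarrow> 'a \<Rightarrow> real" where
  "hilbert_dist P x y =
     (if x = y then 0
      else (case (THE p. is_hilbert_chord P x y p) of (a\<^sub>1, a\<^sub>2) \<Rightarrow>
        1 / 2 * ln ((norm (y - a\<^sub>1) / norm (x - a\<^sub>1)) * (norm (x - a\<^sub>2) / norm (y - a\<^sub>2)))))"

lemma ray_frontier_unique:
  fixes P :: "'a::euclidean_space set"
  assumes "compact P" "convex P" "x \<in> interior P" "l \<noteq> 0"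
  shows "\<exists>d>0. \<forall>t\<ge>0. x + t *\<^sub>R l \<in> frontier P \<longleftrightarrow> t = d"
proof -
  obtain d where d: "0 < d" "x + d *\<^sub>R l \<in> frontier P"
      "\<And>e. \<lbrakk>0 \<le> e; e < d\<rbrakk> \<Longrightarrow> x + e *\<^sub>R l \<in> interior P"
    using ray_to_frontier[OF compact_imp_bounded[OF assms(1)] assms(3) assms(4)] by metis
  have "\<not> d < t" if "x + t *\<^sub>R l \<in> frontier P" "t \<ge> 0" for t
  proof
    assume t: "d < t"
    have "x + t *\<^sub>R l \<in> closure P"
      using that by (simp add: frontier_def)
    moreover have "x + d *\<^sub>R l \<in> open_segment x (x + t *\<^sub>R l)"
      unfolding in_segment using t d(1) assms(4)
      by (intro conjI exI[of _ "d / t"]) (auto simp: algebra_simps)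
    ultimately have "x + d *\<^sub>R l \<in> interior P"
      using in_interior_closure_convex_segment[OF assms(2,3)] by blast
    then show False
      using d(2) by (simp add: frontier_def)
  qed
  moreover have "\<not> t < d" if "x + t *\<^sub>R l \<in> frontier P" "t \<ge> 0" for t
    using d(3)[of t] that by (auto simp: frontier_def)
  ultimately have "\<forall>t\<ge>0. x + t *\<^sub>R l \<in> frontier P \<longleftrightarrow> t = d"
    using d(2) by (metis linorder_less_linear)
  then show ?thesis
    using d(1) by blast
qed

lemma hilbert_chord_unique:
  fixes P :: "'a::euclidean_space set"
  assumes P: "compact P" "convex P" and xy: "x \<in> interior P" "y \<in> interior P" "x \<noteq> y"
  shows "\<exists>!p. is_hilbert_chord P x y p"
proof -
  let ?l = "\<lambda>t. x + t *\<^sub>R (y - x)"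
  have inj: "?l s = ?l t \<longleftrightarrow> s = t" for s t
    using xy(3) by auto
  obtain d where d: "d > 0" "\<And>t. t \<ge> 0 \<Longrightarrow> ?l t \<in> frontier P \<longleftrightarrow> t = d"
    using ray_frontier_unique[OF P xy(1), of "y - x"] xy(3) by auto
  obtain e where e: "e > 0" "\<And>t. t \<ge> 0 \<Longrightarrow> x + t *\<^sub>R (x - y) \<in> frontier P \<longleftrightarrow> t = e"
    using ray_frontier_unique[OF P xy(1), of "x - y"] xy(3) by auto
  have "d \<ge> 1"
  proof (rule ccontr)
    assume "\<not> d \<ge> 1"
    then have "?l d \<in> open_segment y x"
      unfolding in_segment using d(1) xy(3)
      by (intro conjI exI[of _ "1 - d"]) (auto simp: algebra_simps)
    moreover have "x \<in> closure P"
      using xy(1) interior_subset closure_subset by blast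
    ultimately have "?l d \<in> interior P"
      using in_interior_closure_convex_segment[OF P(2) xy(2)] by blast
    moreover have "?l d \<in> frontier P"
      using d(1) d(2)[of d] by simp
    ultimately show False
      by (simp add: frontier_def)
  qed
  have neg: "?l t \<in> frontier P \<longleftrightarrow> t = - e" if "t \<le> 0" for t
    using e(2)[of "- t"] that by (auto simp: algebra_simps)
  have line: "affine hull {x, y} = range ?l"
    by (auto simp: affine_hull_2_alt)
  have front: "frontier P \<inter> affine hull {x, y} = {?l (- e), ?l d}"
  proof -
    have *: "?l t \<in> frontier P \<longleftrightarrow> t = - e \<or> t = d" for t
      using neg[of t] d(2)[of t] d(1) e(1) by (cases "t \<le> 0") auto
    show ?thesis
      unfolding line using * by (intro set_eqI) (simp only: Int_iff image_iff insert_iff empty_iff, metis UNIV_I)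
  qed
  have bt1: "between (?l s, y) x \<longleftrightarrow> s \<le> 0" for s
  proof
    assume "between (?l s, y) x"
    then obtain u where u: "0 \<le> u" "u \<le> 1" "x = (1 - u) *\<^sub>R ?l s + u *\<^sub>R y"
      by (auto simp: between_def in_segment)
    have "?l 0 = ?l ((1 - u) * s + u)"
      using u(3) by (simp add: algebra_simps)
    then have eq: "(1 - u) * s + u = 0"
      unfolding inj by simp
    show "s \<le> 0"
    proof (rule ccontr)
      assume "\<not> s \<le> 0"
      then have "(1 - u) * s \<ge> 0" using u by simp
      then have "u = 0" using eq u by linarith
      then show False using eq \<open>\<not> s \<le> 0\<close> by simp
    qed
  next
    assume s: "s \<le> 0"
    define u where "u = - s / (1 - s)"
    have us: "(1 - u) * s + u = 0" "0 \<le> u" "u \<le> 1"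
      using s by (auto simp: u_def field_simps)
    have "(1 - u) *\<^sub>R ?l s + u *\<^sub>R y = ?l ((1 - u) * s + u)"
      by (simp add: algebra_simps)
    also have "\<dots> = x"
      by (simp add: us(1))
    finally show "between (?l s, y) x"
      unfolding between_def using us by (auto simp: in_segment intro!: exI[of _ u])
  qed
  have bt2: "between (x, ?l s) y \<longleftrightarrow> s \<ge> 1" for s
  proof
    assume "between (x, ?l s) y"
    then obtain u where u: "0 \<le> u" "u \<le> 1" "y = (1 - u) *\<^sub>R x + u *\<^sub>R ?l s"
      by (auto simp: between_def in_segment)
    have "?l 1 = ?l (u * s)"
      using u(3) by (simp add: algebra_simps)
    then have "u * s = 1"
      unfolding inj by simp
    then show "s \<ge> 1"
      using u mult_left_le_one_le[of s u] mult_nonneg_nonpos[of u s] by linarith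
  next
    assume s: "s \<ge> 1"
    have "(1 - inverse s) *\<^sub>R x + inverse s *\<^sub>R ?l s = ?l (inverse s * s)"
      by (simp add: algebra_simps)
    also have "\<dots> = y"
      using s by simp
    finally show "between (x, ?l s) y"
      unfolding between_def using s
      by (auto simp: in_segment inverse_le_1_iff intro!: exI[of _ "inverse s"])
  qed
  show ?thesis
  proof (rule ex1I[of _ "(?l (- e), ?l d)"])
    show "is_hilbert_chord P x y (?l (- e), ?l d)"
      unfolding is_hilbert_chord_def using front bt1[of "- e"] bt2[of d] e(1) \<open>d \<ge> 1\<close> by auto
  next
    fix p assume "is_hilbert_chord P x y p"
    then obtain a b where p: "p = (a, b)" and ab: "{?l (- e), ?l d} = {a, b}"
        and bt: "between (a, y) x" "between (x, b) y"
      unfolding is_hilbert_chord_def front by (cases p) auto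
    have "a \<noteq> ?l d"
      using bt(1) bt1[of d] d(1) by auto
    moreover have "b \<noteq> ?l (- e)"
      using bt(2) bt2[of "- e"] e(1) by auto
    ultimately show "p = (?l (- e), ?l d)"
      using ab p by (auto simp: doubleton_eq_iff)
  qed
qed

definition is_norm :: "('a::real_vector \<Rightarrow> real) \<Rightarrow> bool" where
  "is_norm N \<longleftrightarrow>
     (\<forall>v. 0 \<le> N v) \<and> (\<forall>v. N v = 0 \<longleftrightarrow> v = 0) \<and>
     (\<forall>c v. N (c *\<^sub>R v) = \<bar>c\<bar> * N v) \<and> (\<forall>v w. N (v + w) \<le> N v + N w)"

definition bilipschitz_on ::
    "'a set \<Rightarrow> ('a \<Rightarrow> 'a \<Rightarrow> real) \<Rightarrow> ('b::real_vector \<Rightarrow> real) \<Rightarrow> ('a \<Rightarrow> 'b) \<Rightarrow> bool" where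
  "bilipschitz_on S d N F \<longleftrightarrow>
     (\<exists>L\<ge>1. \<forall>x\<in>S. \<forall>y\<in>S.
        inverse L * d x y \<le> N (F x - F y) \<and> N (F x - F y) \<le> L * d x y)"

text \<open>\<open>C\<^sup>k\<close> on an open subset of a finite-dimensional space, by means of iterated directional
  derivatives.\<close>

primrec Ck_on :: "nat \<Rightarrow> 'a::real_normed_vector set \<Rightarrow> ('a \<Rightarrow> 'b::real_normed_vector) \<Rightarrow> bool" where
  "Ck_on 0 S F \<longleftrightarrow> continuous_on S F"
| "Ck_on (Suc k) S F \<longleftrightarrow>
     (\<forall>x\<in>S. F differentiable (at x)) \<and>
     (\<forall>v. Ck_on k S (\<lambda>x. frechet_derivative F (at x) v))"

definition smooth_on :: "'a::real_normed_vector set \<Rightarrow> ('a \<Rightarrow> 'b::real_normed_vector) \<Rightarrow> bool" where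
  "smooth_on S F \<longleftrightarrow> (\<forall>k. Ck_on k S F)"

definition diffeomorphism ::
    "'a::real_normed_vector set \<Rightarrow> 'b::real_normed_vector set \<Rightarrow> ('a \<Rightarrow> 'b) \<Rightarrow> bool" where
  "diffeomorphism S T F \<longleftrightarrow>
     open S \<and> open T \<and> bij_betw F S T \<and> smooth_on S F \<and> smooth_on T (inv_into S F)"

definition log_differential_map ::
    "nat \<Rightarrow> (nat \<Rightarrow> 'a::euclidean_space \<Rightarrow> real) \<Rightarrow> 'a \<Rightarrow> ('a \<Rightarrow>\<^sub>L real)" where
  "log_differential_map m f x = (\<Sum>i = 1..m. ln (f i x) *\<^sub>R differential (f i))"

end

theory Submission
  imports Defs
begin

text \<open>
  Identify the dual space with the space itself by the inner product. With \<open>f\<^sub>i x = n\<^sub>i \<bullet> x + c\<^sub>i\<close>, the map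
  becomes \<open>x \<mapsto> \<Sum>\<^sub>i ln (f\<^sub>i x) n\<^sub>i\<close>, the gradient of a strictly convex function on the interior of \<open>P\<close>. All
  estimates are in terms of \<open>g\<^sub>i = ln (f\<^sub>i x) - ln (f\<^sub>i y)\<close>.

  On the one hand, the Hilbert distance is half the oscillation \<open>max\<^sub>i g\<^sub>i - min\<^sub>i g\<^sub>i\<close>: the point where the ray
  from \<open>x\<close> through \<open>y\<close> leaves \<open>P\<close> is a zero of the \<open>f\<^sub>i\<close> that decreases by the largest factor from \<open>x\<close> to \<open>y\<close>, and
  similarly for the opposite ray (\<open>chord_end_ratio\<close>, \<open>hilbert_dist_eq_Max\<close>). As \<open>P\<close> is bounded, some \<open>g\<^sub>i\<close> is
  positive and some is negative if \<open>x \<noteq> y\<close>, so the distance is comparable to \<open>\<Sum>\<^sub>i \<bar>g\<^sub>i\<bar>\<close>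
  (\<open>hilbert_dist_bounds\<close>).

  On the other hand, the difference of the images is \<open>\<Sum>\<^sub>i g\<^sub>i n\<^sub>i\<close>, whose norm is at most a constant times
  \<open>\<Sum>\<^sub>i \<bar>g\<^sub>i\<bar>\<close>. The converse estimate is the crux, because the \<open>n\<^sub>i\<close> are linearly dependent. As the logarithm is
  increasing, \<open>g\<^sub>i\<close> has the sign of \<open>n\<^sub>i \<bullet> (x - y)\<close>. If \<open>v\<close> is any vector for which the numbers \<open>n\<^sub>i \<bullet> v\<close> have
  these signs, then pairing \<open>\<Sum>\<^sub>i g\<^sub>i n\<^sub>i\<close> with \<open>v\<close> gives \<open>\<Sum>\<^sub>i \<bar>g\<^sub>i\<bar> \<bar>n\<^sub>i \<bullet> v\<bar>\<close>, without cancellation. There are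
  finitely many sign patterns; choosing one \<open>v\<close> for each gives a uniform constant
  (\<open>sign_compatible_combination_lower_bound\<close>).

  The same estimate gives injectivity and a closed image; invariance of domain gives an open image, so the
  map is onto (\<open>log_gradient_image\<close>). Its derivative is positive definite, so the inverse is differentiable;
  that it is smooth follows from a system of functions, closed under differentiation up to polynomial
  expressions, that contains the derivative of the inverse (\<open>Ck_on_solution\<close>).
\<close>

section \<open>Functions of class \<open>C\<^sup>k\<close>\<close>

lemma Ck_on_continuous: "Ck_on k S F \<Longrightarrow> continuous_on S F"
  by (cases k) (auto intro: differentiable_imp_continuous_on simp: differentiable_on_def differentiable_at_withinI)

lemma Ck_on_cong:
  assumes "open S" "\<And>x. x \<in> S \<Longrightarrow> F x = G x" "Ck_on k S F"
  shows "Ck_on k S G"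
  using assms(2,3)
proof (induction k arbitrary: F G)
  case 0
  then show ?case
    using continuous_on_cong by (metis Ck_on.simps(1))
next
  case (Suc k)
  have D: "(G has_derivative frechet_derivative F (at x)) (at x)" if "x \<in> S" for x
    using Suc.prems that
    by (intro has_derivative_transform_within_open[OF _ assms(1) that Suc.prems(1)])
      (auto simp: frechet_derivative_works)
  then have eq: "frechet_derivative F (at x) v = frechet_derivative G (at x) v" if "x \<in> S" for x v
    using frechet_derivative_at that by metis
  have "Ck_on k S (\<lambda>x. frechet_derivative G (at x) v)" for v
    using Suc.prems(2) by (intro Suc.IH[OF eq[where v = v]]) auto
  with D show ?case
    unfolding Ck_on.simps differentiable_def by blast
qed

text \<open>The directional derivatives in \<^const>\<open>Ck_on\<close> are built from \<^const>\<open>frechet_derivative\<close>, which is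
determined only where a derivative exists. On an open set any explicit formula for the derivative
may replace it.\<close>

lemma Ck_on_SucI:
  assumes "open S" "\<And>x. x \<in> S \<Longrightarrow> (F has_derivative D x) (at x)"
    and "\<And>v. Ck_on k S (\<lambda>x. D x v)"
  shows "Ck_on (Suc k) S F"
proof -
  have "Ck_on k S (\<lambda>x. frechet_derivative F (at x) v)" for v
    by (rule Ck_on_cong[OF assms(1) _ assms(3)[of v]]) (use assms(2) frechet_derivative_at in metis)
  then show ?thesis
    using assms(2) by (auto intro: differentiableI)
qed

lemma Ck_on_SucD:
  assumes "Ck_on (Suc k) S F"
  shows "Ck_on k S F"
  using assms
proof (induction k arbitrary: F)
  case 0
  then show ?case
    using Ck_on_continuous[of "Suc 0" S F] by simp
next
  case (Suc k)
  then show ?case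
    by (subst Ck_on.simps) (metis Ck_on.simps(2))
qed

lemma Ck_on_has_derivative:
  assumes "Ck_on (Suc k) S F" "x \<in> S"
  shows "(F has_derivative frechet_derivative F (at x)) (at x)"
  using assms by (simp add: frechet_derivative_works)

lemma Ck_on_const: "open S \<Longrightarrow> Ck_on k S (\<lambda>_. a)"
proof (induction k arbitrary: a)
  case (Suc k)
  then show ?case by (intro Ck_on_SucI[where D = "\<lambda>_ _. 0"]) auto
qed simp

lemma Ck_on_bounded_linear_image:
  assumes "bounded_linear L" "open S" "Ck_on k S F"
  shows "Ck_on k S (\<lambda>x. L (F x))"
  using assms(3)
proof (induction k arbitrary: F)
  case 0
  then show ?case
    using bounded_linear.continuous_on[OF assms(1)] by simp
next
  case (Suc k)
  have "((\<lambda>x. L (F x)) has_derivative (\<lambda>v. L (frechet_derivative F (at x) v))) (at x)" if "x \<in> S" for x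
    using bounded_linear.has_derivative[OF assms(1) Ck_on_has_derivative[OF Suc.prems that]] .
  then show ?case
    using Suc by (intro Ck_on_SucI[OF assms(2)]) auto
qed

lemma Ck_on_add:
  assumes "open S" "Ck_on k S F" "Ck_on k S G"
  shows "Ck_on k S (\<lambda>x. F x + G x)"
  using assms(2,3)
proof (induction k arbitrary: F G)
  case 0
  then show ?case
    by (simp add: continuous_on_add)
next
  case (Suc k)
  show ?case
    by (rule Ck_on_SucI[OF assms(1) has_derivative_add[OF Ck_on_has_derivative Ck_on_has_derivative]])
      (use Suc in auto)
qed

lemma Ck_on_sum:
  assumes "open S" "\<And>i. i \<in> I \<Longrightarrow> Ck_on k S (F i)"
  shows "Ck_on k S (\<lambda>x. \<Sum>i\<in>I. F i x)"
  using assms(2)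
  by (induction I rule: infinite_finite_induct) (simp_all add: Ck_on_const Ck_on_add assms(1))

text \<open>By the product rule each directional derivative is a sum of two products of the same kind with one
order of regularity less.\<close>

lemma Ck_on_bilinear:
  assumes "bounded_bilinear B" "open S" "Ck_on k S F" "Ck_on k S G"
  shows "Ck_on k S (\<lambda>x. B (F x) (G x))"
  using assms(3,4)
proof (induction k arbitrary: F G)
  case 0
  then show ?case
    using bounded_bilinear.continuous_on[OF assms(1)] by simp
next
  case (Suc k)
  show ?case
  proof (rule Ck_on_SucI[OF assms(2)])
    show "((\<lambda>x. B (F x) (G x)) has_derivative
        (\<lambda>v. B (F x) (frechet_derivative G (at x) v) + B (frechet_derivative F (at x) v) (G x))) (at x)"
      if "x \<in> S" for x
      using Suc.prems that
      by (intro bounded_bilinear.FDERIV[OF assms(1)] Ck_on_has_derivative)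
    show "Ck_on k S (\<lambda>x. B (F x) (frechet_derivative G (at x) v) + B (frechet_derivative F (at x) v) (G x))" for v
      using Suc.prems Ck_on_SucD[OF Suc.prems(1)] Ck_on_SucD[OF Suc.prems(2)]
      by (intro Ck_on_add[OF assms(2)] Suc.IH) auto
  qed
qed

lemma Ck_on_linear_precompose:
  assumes "bounded_linear L" "open S" "open T" "L ` S \<subseteq> T" "Ck_on k T F"
  shows "Ck_on k S (\<lambda>x. F (L x))"
  using assms(5)
proof (induction k arbitrary: F)
  case 0
  then show ?case
    using continuous_on_compose2[of T F S L] assms(1,4) linear_continuous_on by auto
next
  case (Suc k)
  have "((\<lambda>x. F (L x)) has_derivative (\<lambda>v. frechet_derivative F (at (L x)) (L v))) (at x)"
    if "x \<in> S" for x
    by (rule has_derivative_compose[OF bounded_linear_imp_has_derivative[OF assms(1)] Ck_on_has_derivative[OF Suc.prems]])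
      (use assms(4) that in auto)
  moreover have "Ck_on k S (\<lambda>x. frechet_derivative F (at (L x)) (L v))" for v
    using Suc.prems by (intro Suc.IH) auto
  ultimately show ?case
    by (rule Ck_on_SucI[OF assms(2)])
qed

text \<open>The derivative of \<open>1 / s\<close> is a multiple of \<open>(1 / s)\<^sup>2\<close>, hence the induction on \<open>k\<close> closes with products alone.\<close>

lemma Ck_on_inverse_affine:
  assumes "open S" "\<And>x. x \<in> S \<Longrightarrow> l \<bullet> x + c > (0::real)"
  shows "Ck_on k S (\<lambda>x. inverse (l \<bullet> x + c))"
proof (induction k)
  case 0
  show ?case
    using assms(2) by (force intro!: continuous_intros)
next
  case (Suc k)
  show ?case
  proof (rule Ck_on_SucI[OF assms(1)])
    show "((\<lambda>x. inverse (l \<bullet> x + c)) has_derivative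
        (\<lambda>v. - (l \<bullet> v) *\<^sub>R (inverse (l \<bullet> x + c) * inverse (l \<bullet> x + c)))) (at x)" if "x \<in> S" for x
      using assms(2)[OF that] by (auto intro!: derivative_eq_intros simp: algebra_simps)
    show "Ck_on k S (\<lambda>x. - (l \<bullet> v) *\<^sub>R (inverse (l \<bullet> x + c) * inverse (l \<bullet> x + c)))" for v
      by (intro Ck_on_bilinear[OF bounded_bilinear_scaleR] Ck_on_bilinear[OF bounded_bilinear_mult]
          assms(1) Ck_on_const Suc)
  qed
qed

lemma Ck_on_ln_affine:
  assumes "open S" "\<And>x. x \<in> S \<Longrightarrow> l \<bullet> x + c > (0::real)"
  shows "Ck_on k S (\<lambda>x. ln (l \<bullet> x + c))"
proof (rule Ck_on_SucD, rule Ck_on_SucI[OF assms(1)])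
  show "((\<lambda>x. ln (l \<bullet> x + c)) has_derivative (\<lambda>v. (l \<bullet> v) *\<^sub>R inverse (l \<bullet> x + c))) (at x)"
    if "x \<in> S" for x
    using assms(2)[OF that] by (auto intro!: derivative_eq_intros simp: field_simps)
  show "Ck_on k S (\<lambda>x. (l \<bullet> v) *\<^sub>R inverse (l \<bullet> x + c))" for v
    using assms by (intro Ck_on_bilinear[OF bounded_bilinear_scaleR] Ck_on_const Ck_on_inverse_affine)
qed

section \<open>Norms and linear combinations of given vectors\<close>

lemma is_norm_sum_scaleR_le:
  assumes "is_norm M"
  shows "M (\<Sum>i\<in>I. r i *\<^sub>R w i) \<le> (\<Sum>i\<in>I. \<bar>r i\<bar> * M (w i))"
proof -
  have eq0: "M 0 = 0" and scale: "M (s *\<^sub>R v) = \<bar>s\<bar> * M v" and tri: "M (v + u) \<le> M v + M u" for v u s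
    using assms unfolding is_norm_def by auto
  show ?thesis
  proof (induction I rule: infinite_finite_induct)
    case (insert i I)
    then show ?case
      using tri[of "r i *\<^sub>R w i" "\<Sum>i\<in>I. r i *\<^sub>R w i"] by (simp add: scale)
  qed (simp_all add: eq0)
qed

text \<open>A norm is Lipschitz for the Euclidean norm, hence it has a minimum on the unit sphere, which is
positive.\<close>

lemma norm_equivalence_lower:
  fixes M :: "'a::euclidean_space \<Rightarrow> real"
  assumes "is_norm M"
  obtains a where "a > 0" "\<And>w. a * norm w \<le> M w"
proof -
  have nonneg: "0 \<le> M v" and eq0: "M v = 0 \<longleftrightarrow> v = 0" and scale: "M (r *\<^sub>R v) = \<bar>r\<bar> * M v"
    and tri: "M (v + w) \<le> M v + M w" for v w r
    using assms unfolding is_norm_def by auto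
  define C where "C = (\<Sum>b\<in>Basis. M b)"
  have upper: "M w \<le> C * norm w" for w
  proof -
    have "M w \<le> (\<Sum>b\<in>Basis. \<bar>w \<bullet> b\<bar> * M b)"
      using is_norm_sum_scaleR_le[OF assms, of "\<lambda>b. w \<bullet> b" "\<lambda>b. b" Basis]
      by (simp add: euclidean_representation)
    also have "\<dots> \<le> (\<Sum>b\<in>Basis. norm w * M b)"
      by (intro sum_mono mult_right_mono Basis_le_norm nonneg)
    finally show ?thesis
      by (simp add: C_def sum_distrib_left mult.commute)
  qed
  have "\<bar>M v - M w\<bar> \<le> C * norm (v - w)" for v w
    using tri[of w "v - w"] tri[of v "w - v"] upper[of "v - w"] upper[of "w - v"]
    by (simp add: norm_minus_commute abs_le_iff)
  moreover have "C \<ge> 0"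
    unfolding C_def by (simp add: sum_nonneg nonneg)
  ultimately have "C-lipschitz_on UNIV M"
    by (intro lipschitz_onI) (auto simp: dist_norm)
  then have "continuous_on (sphere 0 1) M"
    using lipschitz_on_continuous_on continuous_on_subset by blast
  moreover have "sphere (0::'a) 1 \<noteq> {}"
    by (simp add: sphere_eq_empty)
  ultimately obtain u where u: "u \<in> sphere 0 1" "\<And>w. w \<in> sphere 0 1 \<Longrightarrow> M u \<le> M w"
    using continuous_attains_inf[of "sphere (0::'a) 1" M] by auto
  have "M u * norm w \<le> M w" for w
  proof (cases "w = 0")
    case False
    then have "M u \<le> M ((1 / norm w) *\<^sub>R w)"
      by (intro u(2)) simp
    then show ?thesis
      using False by (simp add: scale divide_simps)
  qed (use eq0[of 0] in simp)
  moreover have "M u > 0"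
    using u(1) nonneg[of u] eq0[of u] by fastforce
  ultimately show ?thesis
    using that by blast
qed

text \<open>The vectors \<open>n i\<close> may be linearly dependent, so the norm on the right can vanish for general nonzero \<open>g\<close>. It cannot
if \<open>g\<close> has the signs of the values \<open>n i \<bullet> v\<close> of one vector \<open>v\<close>: pairing \<open>\<Sum>i\<in>I. g i *\<^sub>R n i\<close> with \<open>v\<close> yields
\<open>\<Sum>i\<in>I. \<bar>g i\<bar> * \<bar>n i \<bullet> v\<bar>\<close>, without cancellation. The constant so obtained depends on \<open>v\<close>, and degenerates
as \<open>v\<close> varies, but for given \<open>g\<close> any \<open>v\<close> with the right sign pattern serves, and there are only finitely
many patterns: one representative \<open>v\<close> of each gives a uniform constant.\<close>

lemma sign_compatible_combination_lower_bound:
  fixes n :: "'i \<Rightarrow> 'a::euclidean_space"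
  assumes "finite I"
  obtains c where "c > 0"
    "\<And>g v. (\<And>i. i \<in> I \<Longrightarrow> sgn (g i) = sgn (n i \<bullet> v))
       \<Longrightarrow> c * (\<Sum>i\<in>I. \<bar>g i\<bar>) \<le> norm (\<Sum>i\<in>I. g i *\<^sub>R n i)"
proof -
  define pattern where "pattern v = restrict (\<lambda>i. sgn (n i \<bullet> v)) I" for v
  define compatible where "compatible p g \<longleftrightarrow> (\<forall>i\<in>I. sgn (g i) = p i)" for p g :: "'i \<Rightarrow> real"
  have one: "\<exists>c>0. \<forall>g. compatible (pattern v) g \<longrightarrow> c * (\<Sum>i\<in>I. \<bar>g i\<bar>) \<le> norm (\<Sum>i\<in>I. g i *\<^sub>R n i)" for v
  proof -
    \<comment> \<open>The element \<open>1\<close> below only keeps the minimum defined if \<open>v\<close> is orthogonal to all \<open>n i\<close>.\<close>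
    obtain \<mu> where \<mu>: "\<mu> > 0" "\<And>i. i \<in> I \<Longrightarrow> n i \<bullet> v \<noteq> 0 \<Longrightarrow> \<mu> \<le> \<bar>n i \<bullet> v\<bar>"
    proof
      let ?A = "insert 1 ((\<lambda>i. \<bar>n i \<bullet> v\<bar>) ` {i\<in>I. n i \<bullet> v \<noteq> 0})"
      show "Min ?A > 0"
        using assms by (subst Min_gr_iff) auto
      show "Min ?A \<le> \<bar>n i \<bullet> v\<bar>" if "i \<in> I" "n i \<bullet> v \<noteq> 0" for i
        using assms that by (intro Min_le) auto
    qed
    \<comment> \<open>\<open>norm v + 1\<close> instead of \<open>norm v\<close> allows division also for \<open>v = 0\<close>.\<close>
    have "\<mu> * (\<Sum>i\<in>I. \<bar>g i\<bar>) \<le> norm (\<Sum>i\<in>I. g i *\<^sub>R n i) * (norm v + 1)"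
      if "compatible (pattern v) g" for g
    proof -
      have "\<mu> * \<bar>g i\<bar> \<le> g i * (n i \<bullet> v)" if "i \<in> I" for i
      proof -
        have s: "sgn (g i) = sgn (n i \<bullet> v)"
          using \<open>compatible (pattern v) g\<close> that by (simp add: compatible_def pattern_def)
        then have "g i * (n i \<bullet> v) = \<bar>g i\<bar> * \<bar>n i \<bullet> v\<bar>"
          by (metis abs_sgn mult.commute mult.left_commute sgn_mult_abs mult_sgn_abs)
        then show ?thesis
          using mult_right_mono[OF \<mu>(2)[OF that], of "\<bar>g i\<bar>"] s
          by (cases "n i \<bullet> v = 0") (auto simp: sgn_0_0 mult.commute)
      qed
      then have "\<mu> * (\<Sum>i\<in>I. \<bar>g i\<bar>) \<le> (\<Sum>i\<in>I. g i * (n i \<bullet> v))"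
        by (simp add: sum_distrib_left sum_mono)
      also have "\<dots> = (\<Sum>i\<in>I. g i *\<^sub>R n i) \<bullet> v"
        by (simp add: inner_sum_left)
      also have "\<dots> \<le> norm (\<Sum>i\<in>I. g i *\<^sub>R n i) * norm v"
        by (rule norm_cauchy_schwarz)
      also have "\<dots> \<le> norm (\<Sum>i\<in>I. g i *\<^sub>R n i) * (norm v + 1)"
        by (intro mult_left_mono) auto
      finally show ?thesis .
    qed
    moreover have "norm v + 1 > 0"
      using norm_ge_zero[of v] by linarith
    ultimately show ?thesis
      using \<mu>(1) by (intro exI[of _ "\<mu> / (norm v + 1)"]) (simp add: pos_divide_le_eq)
  qed
  obtain C where C: "\<And>v. C (pattern v) > 0" "\<And>v g. compatible (pattern v) g \<Longrightarrow>
      C (pattern v) * (\<Sum>i\<in>I. \<bar>g i\<bar>) \<le> norm (\<Sum>i\<in>I. g i *\<^sub>R n i)"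
  proof -
    have "\<forall>p. \<exists>c. p \<in> range pattern \<longrightarrow> c > 0 \<and> (\<forall>g. compatible p g \<longrightarrow> c * (\<Sum>i\<in>I. \<bar>g i\<bar>) \<le> norm (\<Sum>i\<in>I. g i *\<^sub>R n i))"
      using one by blast
    then show ?thesis
      using that by (metis rangeI)
  qed
  have "range pattern \<subseteq> PiE I (\<lambda>_. {-1, 0, 1})"
    by (auto simp: pattern_def sgn_real_def split: if_splits)
  then have fin: "finite (range pattern)"
    using assms by (metis finite_PiE finite_subset finite.emptyI finite.insertI)
  let ?c = "Min (range (\<lambda>v. C (pattern v)))"
  have fin': "finite (range (\<lambda>v. C (pattern v)))"
    using finite_imageI[OF fin, of C] by (simp add: image_image)
  show ?thesis
  proof
    show "?c > 0"
      using fin' C(1) by (subst Min_gr_iff) auto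
    fix g v assume "\<And>i. i \<in> I \<Longrightarrow> sgn (g i) = sgn (n i \<bullet> v)"
    then have "compatible (pattern v) g"
      by (simp add: compatible_def pattern_def)
    moreover have "?c * (\<Sum>i\<in>I. \<bar>g i\<bar>) \<le> C (pattern v) * (\<Sum>i\<in>I. \<bar>g i\<bar>)"
      using fin' by (intro mult_right_mono Min_le sum_nonneg) auto
    ultimately show "?c * (\<Sum>i\<in>I. \<bar>g i\<bar>) \<le> norm (\<Sum>i\<in>I. g i *\<^sub>R n i)"
      using C(2)[of v g] by linarith
  qed
qed

section \<open>Bounded polyhedra and their Hilbert metric\<close>

locale bounded_polyhedron =
  fixes I :: "'i set" and n :: "'i \<Rightarrow> 'a::euclidean_space" and c :: "'i \<Rightarrow> real" and P :: "'a set"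
  assumes finite_I: "finite I"
    and normal_nonzero: "i \<in> I \<Longrightarrow> n i \<noteq> 0"
    and P_eq: "P = {x. \<forall>i\<in>I. 0 \<le> n i \<bullet> x + c i}"
    and bounded_P: "bounded P"
    and interior_nonempty: "interior P \<noteq> {}"
begin

definition slack :: "'i \<Rightarrow> 'a \<Rightarrow> real" where
  "slack i x = n i \<bullet> x + c i"

lemma slack_diff: "slack i x - slack i y = n i \<bullet> (x - y)"
  by (simp add: slack_def inner_diff_right)

lemma mem_P: "x \<in> P \<longleftrightarrow> (\<forall>i\<in>I. 0 \<le> slack i x)"
  by (simp add: P_eq slack_def)

lemma continuous_slack [continuous_intros]: "continuous_on S (slack i)"
  unfolding slack_def by (intro continuous_intros)

lemma closed_P: "closed P"
proof -
  have "P = (\<Inter>i\<in>I. {x. 0 \<le> slack i x})"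
    by (auto simp: mem_P)
  then show ?thesis
    by (auto intro!: closed_Collect_le continuous_intros)
qed

lemma convex_P: "convex P"
proof -
  have "P = (\<Inter>i\<in>I. {x. n i \<bullet> x \<ge> - c i})"
    by (force simp: P_eq)
  then show ?thesis
    by (auto intro!: convex_INT convex_halfspace_ge)
qed

lemma interior_eq: "interior P = {x. \<forall>i\<in>I. 0 < slack i x}"
proof (intro equalityI subsetI CollectI ballI)
  fix x i assume x: "x \<in> interior P" and i: "i \<in> I"
  have "x \<in> interior {x. n i \<bullet> x \<ge> - c i}"
    using x i interior_mono[of P "{x. n i \<bullet> x \<ge> - c i}"] by (force simp: P_eq)
  then show "0 < slack i x"
    using normal_nonzero[OF i] by (simp add: interior_halfspace_ge slack_def)
next
  fix x assume "x \<in> {x. \<forall>i\<in>I. 0 < slack i x}"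
  moreover have "{x. \<forall>i\<in>I. 0 < slack i x} = (\<Inter>i\<in>I. {x. 0 < slack i x})"
    by auto
  then have "open {x. \<forall>i\<in>I. 0 < slack i x}"
    using finite_I by (auto intro!: open_INT open_Collect_less continuous_intros)
  moreover have "{x. \<forall>i\<in>I. 0 < slack i x} \<subseteq> P"
    by (force simp: mem_P)
  ultimately show "x \<in> interior P"
    by (meson interior_maximal subsetD)
qed

lemma slack_pos: "x \<in> interior P \<Longrightarrow> i \<in> I \<Longrightarrow> 0 < slack i x"
  by (simp add: interior_eq)

text \<open>Such a \<open>v\<close> is a recession direction: a ray in this direction that starts in \<open>P\<close> stays in \<open>P\<close>.\<close>

lemma recession_trivial:
  assumes "\<And>i. i \<in> I \<Longrightarrow> 0 \<le> n i \<bullet> v"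
  shows "v = 0"
proof (rule ccontr)
  assume "v \<noteq> 0"
  obtain x where x: "x \<in> P"
    using interior_nonempty interior_subset by blast
  obtain B where B: "\<And>y. y \<in> P \<Longrightarrow> norm y \<le> B"
    using bounded_P by (auto simp: bounded_iff)
  define t where "t = (B + norm x + 1) / norm v"
  have "0 \<le> B"
    using B[OF x] norm_ge_zero[of x] by linarith
  then have "t \<ge> 0"
    by (simp add: t_def)
  then have "slack i (x + t *\<^sub>R v) \<ge> slack i x" if "i \<in> I" for i
    using assms[OF that] by (simp add: slack_def inner_add_right)
  then have "x + t *\<^sub>R v \<in> P"
    using x by (force simp: mem_P)
  then have "norm (x + t *\<^sub>R v) \<le> B"
    by (rule B)
  moreover have "norm (t *\<^sub>R v) \<le> norm (x + t *\<^sub>R v) + norm x"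
    by (metis add_diff_cancel_left' norm_triangle_ineq4)
  moreover have "norm (t *\<^sub>R v) = B + norm x + 1"
    using \<open>v \<noteq> 0\<close> \<open>0 \<le> B\<close> by (simp add: t_def)
  ultimately show False
    by linarith
qed

lemma I_nonempty: "I \<noteq> {}"
proof
  assume "I = {}"
  then have "v = 0" for v :: 'a
    using recession_trivial by simp
  moreover obtain b :: 'a where "b \<in> Basis"
    using nonempty_Basis by blast
  ultimately show False
    using nonzero_Basis by blast
qed

text \<open>Write \<open>y = (1 - u) x + u a\<close>. Then the distance ratio is \<open>1 / (1 - u)\<close>, and
\<open>slack i y = (1 - u) * slack i x + u * slack i a\<close>, where the last term is nonnegative for all \<open>i\<close> and,
as \<open>a\<close> is a boundary point, zero for some \<open>i\<close>.\<close>

lemma chord_end_ratio: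
  assumes x: "x \<in> interior P" and y: "y \<in> interior P" and "x \<noteq> y"
    and a: "a \<in> frontier P" and bt: "between (x, a) y"
  shows "(MAX i\<in>I. slack i x / slack i y) = norm (x - a) / norm (y - a)"
    and "norm (x - a) / norm (y - a) > 1"
proof -
  obtain u where u: "0 \<le> u" "u \<le> 1" "y = (1 - u) *\<^sub>R x + u *\<^sub>R a"
    using bt by (auto simp: between_def in_segment)
  have "u \<noteq> 0" "u \<noteq> 1"
    using u(3) \<open>x \<noteq> y\<close> y a by (auto simp: frontier_def)
  then have u01: "0 < u" "u < 1"
    using u by auto
  have "y - a = (1 - u) *\<^sub>R (x - a)"
    by (simp add: u(3) algebra_simps)
  moreover have "x \<noteq> a"
    using x a by (auto simp: frontier_def)
  ultimately have ratio: "norm (x - a) / norm (y - a) = 1 / (1 - u)"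
    using u01 by simp
  then show "norm (x - a) / norm (y - a) > 1"
    using u01 by simp
  have sl: "slack i y = (1 - u) * slack i x + u * slack i a" for i
    by (simp add: u(3) slack_def algebra_simps inner_add_right inner_diff_right)
  have "a \<in> P" "a \<notin> interior P"
    using a closed_P by (auto simp: frontier_def)
  then obtain j where j: "j \<in> I" "slack j a = 0"
    by (force simp: mem_P interior_eq less_le)
  show "(MAX i\<in>I. slack i x / slack i y) = norm (x - a) / norm (y - a)"
    unfolding ratio
  proof (rule Max_eqI)
    show "1 / (1 - u) \<in> (\<lambda>i. slack i x / slack i y) ` I"
      using j u01 slack_pos[OF x j(1)] by (force simp: sl intro!: image_eqI[of _ _ j])
    fix r assume "r \<in> (\<lambda>i. slack i x / slack i y) ` I"
    then obtain i where i: "i \<in> I" "r = slack i x / slack i y"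
      by auto
    have "slack i y \<ge> (1 - u) * slack i x"
      using \<open>a \<in> P\<close> i(1) u01 by (simp add: sl mem_P)
    then show "r \<le> 1 / (1 - u)"
      using slack_pos[OF y i(1)] u01 by (simp add: i(2) field_simps)
  qed (use finite_I in auto)
qed

lemma hilbert_dist_eq_Max:
  assumes "x \<in> interior P" "y \<in> interior P" "x \<noteq> y"
  shows "hilbert_dist P x y =
      1 / 2 * (ln (MAX i\<in>I. slack i x / slack i y) + ln (MAX i\<in>I. slack i y / slack i x))"
    and "(MAX i\<in>I. slack i x / slack i y) > 1"
proof -
  have "compact P"
    using bounded_P closed_P by (simp add: compact_eq_bounded_closed)
  then obtain a b where ab: "is_hilbert_chord P x y (a, b)"
      and the: "(THE p. is_hilbert_chord P x y p) = (a, b)"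
    using hilbert_chord_unique[OF _ convex_P assms] by (metis surj_pair theI_unique)
  from ab have fr: "a \<in> frontier P" "b \<in> frontier P" and bt: "between (y, a) x" "between (x, b) y"
    by (auto simp: is_hilbert_chord_def between_commute)
  note r1 = chord_end_ratio[OF assms fr(2) bt(2)]
  note r2 = chord_end_ratio[OF assms(2,1) assms(3)[symmetric] fr(1) bt(1)]
  show "(MAX i\<in>I. slack i x / slack i y) > 1"
    using r1 by simp
  show "hilbert_dist P x y =
      1 / 2 * (ln (MAX i\<in>I. slack i x / slack i y) + ln (MAX i\<in>I. slack i y / slack i x))"
    unfolding r1(1) r2(1) using assms(3) ln_mult_pos[of "norm (y - a) / norm (x - a)" "norm (x - b) / norm (y - b)"]
      less_trans[OF zero_less_one r1(2)] less_trans[OF zero_less_one r2(2)]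
    by (simp add: hilbert_dist_def the add.commute)
qed

text \<open>In logarithmic slack coordinates \<open>g i = ln (slack i x) - ln (slack i y)\<close> the Hilbert distance is half the
oscillation of \<open>g\<close>. For \<open>x \<noteq> y\<close> the maximum of \<open>g\<close> is positive and its minimum negative, so the oscillation
dominates every \<open>\<bar>g i\<bar>\<close>.\<close>

lemma hilbert_dist_bounds:
  assumes x: "x \<in> interior P" and y: "y \<in> interior P"
  shows "i \<in> I \<Longrightarrow> \<bar>ln (slack i x) - ln (slack i y)\<bar> \<le> 2 * hilbert_dist P x y"
    and "hilbert_dist P x y \<le> (\<Sum>i\<in>I. \<bar>ln (slack i x) - ln (slack i y)\<bar>)"
proof -
  have "(\<forall>i\<in>I. \<bar>ln (slack i x) - ln (slack i y)\<bar> \<le> 2 * hilbert_dist P x y) \<and>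
    hilbert_dist P x y \<le> (\<Sum>i\<in>I. \<bar>ln (slack i x) - ln (slack i y)\<bar>)"
  proof (cases "x = y")
    case True
    then show ?thesis
      by (simp add: hilbert_dist_def)
  next
    case False
    define M where "M x y = (MAX i\<in>I. slack i x / slack i y)" for x y
    have d: "2 * hilbert_dist P x y = ln (M x y) + ln (M y x)" and M: "M x y > 1" "M y x > 1"
      using hilbert_dist_eq_Max[OF x y False] hilbert_dist_eq_Max(2)[OF y x False[symmetric]]
      by (auto simp: M_def)
    have upper: "ln (slack i x) - ln (slack i y) \<le> ln (M x y)"
      if "i \<in> I" "x \<in> interior P" "y \<in> interior P" for i x y
    proof -
      have "slack i x / slack i y \<le> M x y"
        unfolding M_def using finite_I that(1) by (intro Max_ge) auto
      moreover have "slack i x > 0" "slack i y > 0"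
        using that slack_pos by auto
      ultimately have "ln (slack i x / slack i y) \<le> ln (M x y)"
        by (intro ln_mono) auto
      then show ?thesis
        using \<open>slack i x > 0\<close> \<open>slack i y > 0\<close> by (simp add: ln_div)
    qed
    have lower: "ln (M x y) \<le> (\<Sum>i\<in>I. \<bar>ln (slack i x) - ln (slack i y)\<bar>)"
      if "x \<in> interior P" "y \<in> interior P" for x y
    proof -
      have "M x y \<in> (\<lambda>i. slack i x / slack i y) ` I"
        unfolding M_def using finite_I I_nonempty by (intro Max_in) auto
      then obtain i where i: "i \<in> I" "M x y = slack i x / slack i y"
        by auto
      then have "ln (M x y) \<le> \<bar>ln (slack i x) - ln (slack i y)\<bar>"
        using slack_pos[OF that(1) i(1)] slack_pos[OF that(2) i(1)] by (simp add: ln_div)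
      also have "\<dots> \<le> (\<Sum>i\<in>I. \<bar>ln (slack i x) - ln (slack i y)\<bar>)"
        using finite_I i(1) by (intro member_le_sum) auto
      finally show ?thesis .
    qed
    have "ln (M x y) > 0" "ln (M y x) > 0"
      using M by auto
    then show ?thesis
      using d upper[OF _ x y] upper[OF _ y x] lower[OF x y] lower[OF y x]
      by (force simp: abs_le_iff abs_minus_commute)
  qed
  then show "i \<in> I \<Longrightarrow> \<bar>ln (slack i x) - ln (slack i y)\<bar> \<le> 2 * hilbert_dist P x y"
    and "hilbert_dist P x y \<le> (\<Sum>i\<in>I. \<bar>ln (slack i x) - ln (slack i y)\<bar>)"
    by auto
qed

section \<open>The logarithmic gradient map is a bijection\<close>

text \<open>The gradient of the convex potential \<open>\<Sum>i\<in>I. slack i x * ln (slack i x) - slack i x\<close>.\<close>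

definition log_gradient :: "'a \<Rightarrow> 'a" where
  "log_gradient x = (\<Sum>i\<in>I. ln (slack i x) *\<^sub>R n i)"

text \<open>As \<^const>\<open>ln\<close> is increasing, \<open>ln (slack i x) - ln (slack i y)\<close> has the sign of
\<open>slack i x - slack i y = n i \<bullet> (x - y)\<close>, so the family is compatible with \<open>v = x - y\<close>.\<close>

lemma log_gradient_lower_bound:
  "\<exists>k>0. \<forall>x\<in>interior P. \<forall>y\<in>interior P.
     k * (\<Sum>i\<in>I. \<bar>ln (slack i x) - ln (slack i y)\<bar>) \<le> norm (log_gradient x - log_gradient y)"
proof -
  obtain k where k: "k > 0" "\<And>g v. (\<And>i. i \<in> I \<Longrightarrow> sgn (g i) = sgn (n i \<bullet> v))
       \<Longrightarrow> k * (\<Sum>i\<in>I. \<bar>g i\<bar>) \<le> norm (\<Sum>i\<in>I. g i *\<^sub>R n i)"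
    using sign_compatible_combination_lower_bound[OF finite_I] by blast
  show ?thesis
  proof (intro exI conjI ballI)
    show "k > 0" by fact
    fix x y assume xy: "x \<in> interior P" "y \<in> interior P"
    have "sgn (ln (slack i x) - ln (slack i y)) = sgn (n i \<bullet> (x - y))" if "i \<in> I" for i
      unfolding slack_diff[symmetric] using slack_pos[OF xy(1) that] slack_pos[OF xy(2) that]
      by (simp add: sgn_real_def)
    then have "k * (\<Sum>i\<in>I. \<bar>ln (slack i x) - ln (slack i y)\<bar>)
        \<le> norm (\<Sum>i\<in>I. (ln (slack i x) - ln (slack i y)) *\<^sub>R n i)"
      by (rule k(2))
    then show "k * (\<Sum>i\<in>I. \<bar>ln (slack i x) - ln (slack i y)\<bar>) \<le> norm (log_gradient x - log_gradient y)"
      by (simp add: log_gradient_def scaleR_left_diff_distrib sum_subtractf)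
  qed
qed

lemma inj_on_log_gradient: "inj_on log_gradient (interior P)"
proof (rule inj_onI)
  fix x y assume x: "x \<in> interior P" and y: "y \<in> interior P" and eq: "log_gradient x = log_gradient y"
  obtain k where k: "k > 0" "k * (\<Sum>i\<in>I. \<bar>ln (slack i x) - ln (slack i y)\<bar>) \<le> norm (log_gradient x - log_gradient y)"
    using log_gradient_lower_bound x y by blast
  then have "(\<Sum>i\<in>I. \<bar>ln (slack i x) - ln (slack i y)\<bar>) = 0"
    using eq by (intro antisym sum_nonneg) (auto simp: mult_le_0_iff)
  then have "ln (slack i x) = ln (slack i y)" if "i \<in> I" for i
    using finite_I that by (simp add: sum_nonneg_eq_0_iff)
  then have "slack i x = slack i y" if "i \<in> I" for i
    using that ln_inj_iff[OF slack_pos[OF x that] slack_pos[OF y that]] by metis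
  then have "x - y = 0"
    by (intro recession_trivial) (simp add: slack_diff[symmetric])
  then show "x = y"
    by simp
qed

text \<open>The Hessian of the same potential, which is positive definite on the interior of \<open>P\<close> as the normals span.\<close>

definition hessian :: "'a \<Rightarrow> 'a \<Rightarrow> 'a" where
  "hessian x v = (\<Sum>i\<in>I. ((n i \<bullet> v) * inverse (slack i x)) *\<^sub>R n i)"

lemma slack_has_derivative: "(slack i has_derivative (\<lambda>v. n i \<bullet> v)) (at x)"
  unfolding slack_def by (auto intro!: derivative_eq_intros)

lemma log_gradient_has_derivative:
  assumes "x \<in> interior P"
  shows "(log_gradient has_derivative hessian x) (at x)"
  unfolding log_gradient_def[abs_def] hessian_def[abs_def]
proof (rule has_derivative_sum)
  fix i assume "i \<in> I"
  then have "((\<lambda>x. ln (slack i x)) has_derivative (\<lambda>v. (n i \<bullet> v) * inverse (slack i x))) (at x)"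
    using has_derivative_ln[OF _ slack_has_derivative] slack_pos[OF assms] by blast
  then show "((\<lambda>x. ln (slack i x) *\<^sub>R n i) has_derivative
      (\<lambda>v. ((n i \<bullet> v) * inverse (slack i x)) *\<^sub>R n i)) (at x)"
    by (rule has_derivative_scaleR_left)
qed

lemma continuous_log_gradient: "continuous_on (interior P) log_gradient"
  by (rule has_derivative_continuous_on[OF has_derivative_at_withinI[OF log_gradient_has_derivative]])

text \<open>The image is open by invariance of domain. It is closed because a sequence whose images converge keeps
all its slacks bounded away from zero, by the lower bound; hence a limit point in the compact \<open>P\<close> is an
interior point.\<close>

lemma log_gradient_image: "log_gradient ` interior P = UNIV"
proof -
  have "open (log_gradient ` interior P)"
    by (intro invariance_of_domain continuous_log_gradient open_interior inj_on_log_gradient)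
  moreover have "closed (log_gradient ` interior P)"
    unfolding closed_sequential_limits
  proof (intro allI impI, elim conjE)
    fix Y l assume "\<forall>k. Y k \<in> log_gradient ` interior P" and Yl: "Y \<longlonglongrightarrow> l"
    then have "\<forall>k. \<exists>x. x \<in> interior P \<and> Y k = log_gradient x"
      by blast
    then obtain X where X: "\<And>k. X k \<in> interior P" "\<And>k. Y k = log_gradient (X k)"
      by (metis (full_types))
    have "compact P"
      using bounded_P closed_P by (simp add: compact_eq_bounded_closed)
    moreover have "X k \<in> P" for k
      using X(1) interior_subset by blast
    ultimately obtain a r where a: "a \<in> P" "strict_mono r" "(X \<circ> r) \<longlonglongrightarrow> a"
      unfolding compact_def by metis
    obtain K where K: "K > 0" "\<And>x y. x \<in> interior P \<Longrightarrow> y \<in> interior P \<Longrightarrow>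
       K * (\<Sum>i\<in>I. \<bar>ln (slack i x) - ln (slack i y)\<bar>) \<le> norm (log_gradient x - log_gradient y)"
      using log_gradient_lower_bound by blast
    obtain B where B: "\<And>k. norm (Y k) \<le> B"
      using convergent_imp_bounded[OF Yl] by (auto simp: bounded_iff)
    have "slack i a > 0" if i: "i \<in> I" for i
    proof -
      \<comment> \<open>\<open>2 * B\<close> bounds the distance of any two members of \<open>Y\<close>; the lower bound turns it into one for \<open>ln (slack i)\<close>.\<close>
      define e where "e = exp (ln (slack i (X 0)) - 2 * B / K)"
      have "e \<le> slack i (X k)" for k
      proof -
        have "K * \<bar>ln (slack i (X 0)) - ln (slack i (X k))\<bar>
            \<le> K * (\<Sum>i\<in>I. \<bar>ln (slack i (X 0)) - ln (slack i (X k))\<bar>)"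
          using K(1) finite_I i member_le_sum[OF i, of "\<lambda>i. \<bar>ln (slack i (X 0)) - ln (slack i (X k))\<bar>"]
          by (intro mult_left_mono) auto
        also have "\<dots> \<le> norm (Y 0 - Y k)"
          unfolding X(2) by (intro K(2) X(1))
        also have "\<dots> \<le> 2 * B"
          using norm_triangle_ineq4[of "Y 0" "Y k"] B[of 0] B[of k] by linarith
        finally have "\<bar>ln (slack i (X 0)) - ln (slack i (X k))\<bar> \<le> 2 * B / K"
          using K(1) by (simp add: field_simps)
        then have "ln (slack i (X 0)) - 2 * B / K \<le> ln (slack i (X k))"
          by linarith
        then show ?thesis
          unfolding e_def using slack_pos[OF X(1) i] by (metis exp_le_cancel_iff exp_ln)
      qed
      moreover have "(\<lambda>k. slack i ((X \<circ> r) k)) \<longlonglongrightarrow> slack i a"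
        unfolding slack_def by (intro tendsto_intros a(3))
      ultimately have "e \<le> slack i a"
        by (intro tendsto_lowerbound[of _ "slack i a" sequentially]) auto
      then show ?thesis
        unfolding e_def by (rule less_le_trans[OF exp_gt_zero])
    qed
    then have int: "a \<in> interior P"
      by (simp add: interior_eq)
    then have "isCont log_gradient a"
      using continuous_log_gradient continuous_on_interior by (metis interior_interior)
    then have "(\<lambda>k. log_gradient ((X \<circ> r) k)) \<longlonglongrightarrow> log_gradient a"
      using a(3) isCont_tendsto_compose by blast
    moreover have "(\<lambda>k. log_gradient ((X \<circ> r) k)) \<longlonglongrightarrow> l"
      using LIMSEQ_subseq_LIMSEQ[OF Yl a(2)] by (simp add: o_def X(2)[symmetric])
    ultimately show "l \<in> log_gradient ` interior P"
      using int LIMSEQ_unique by blast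
  qed
  ultimately show ?thesis
    by (metis clopen interior_nonempty image_is_empty)
qed

lemma linear_hessian: "linear (hessian x)"
  unfolding hessian_def[abs_def]
  by (intro linear_compose_sum ballI linearI) (simp_all add: inner_add_right distrib_right scaleR_add_left)

lemma bij_hessian:
  assumes "x \<in> interior P"
  shows "bij (hessian x)"
proof -
  have "v = 0" if "hessian x v = 0" for v
  proof -
    have "0 = hessian x v \<bullet> v"
      using that by simp
    also have "\<dots> = (\<Sum>i\<in>I. (n i \<bullet> v)\<^sup>2 * inverse (slack i x))"
      by (simp add: hessian_def inner_sum_left power2_eq_square mult_ac)
    finally have "\<forall>i\<in>I. (n i \<bullet> v)\<^sup>2 * inverse (slack i x) = 0"
      using slack_pos[OF assms] finite_I by (subst (asm) eq_commute, subst (asm) sum_nonneg_eq_0_iff) (auto simp: less_imp_le)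
    then show "v = 0"
      using slack_pos[OF assms] by (intro recession_trivial) force
  qed
  then have "inj (hessian x)"
    using linear_injective_0[OF linear_hessian] by blast
  then show ?thesis
    using linear_injective_imp_surjective[OF linear_hessian] by (simp add: bij_def)
qed

section \<open>Smoothness of the inverse of the logarithmic gradient map\<close>

definition solution :: "'a \<Rightarrow> 'a" where
  "solution = inv_into (interior P) log_gradient"

definition solution_derivative :: "'a \<Rightarrow> 'a \<Rightarrow> 'a" where
  "solution_derivative y = inv (hessian (solution y))"

lemma solution: "solution y \<in> interior P" "log_gradient (solution y) = y"
  unfolding solution_def using log_gradient_image by (auto intro: inv_into_into f_inv_into_f)

lemma solution_log_gradient: "x \<in> interior P \<Longrightarrow> solution (log_gradient x) = x"
  unfolding solution_def using inj_on_log_gradient by simp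

lemma hessian_solution_derivative: "hessian (solution y) (solution_derivative y w) = w"
  unfolding solution_derivative_def using bij_hessian[OF solution(1)] by (simp add: bij_is_surj surj_f_inv_f)

lemma solution_derivative_hessian: "solution_derivative y (hessian (solution y) w) = w"
  unfolding solution_derivative_def using bij_hessian[OF solution(1)] by (simp add: bij_is_inj)

lemma linear_solution_derivative: "linear (solution_derivative y)"
  unfolding solution_derivative_def
  using linear_hessian bij_hessian[OF solution(1)]
  by (intro inj_linear_imp_inv_linear) (auto simp: bij_is_inj)

lemma solution_has_derivative: "(solution has_derivative solution_derivative y) (at y)"
  by (rule has_derivative_inverse_strong_x[OF open_interior solution(1) continuous_log_gradient
        solution_log_gradient log_gradient_has_derivative[OF solution(1)]])
    (auto simp: hessian_solution_derivative solution)

text \<open>The derivative at \<open>x\<close>, in direction \<open>d\<close>, of \<open>hessian x v\<close> with \<open>v\<close> held constant.\<close>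

definition hessian_variation :: "'a \<Rightarrow> 'a \<Rightarrow> 'a \<Rightarrow> 'a" where
  "hessian_variation x v d = - (\<Sum>i\<in>I. ((n i \<bullet> v) * (n i \<bullet> d) * (inverse (slack i x) * inverse (slack i x))) *\<^sub>R n i)"

lemma hessian_has_derivative:
  assumes "x \<in> interior P"
  shows "((\<lambda>p. hessian (fst p) (snd p)) has_derivative
      (\<lambda>q. hessian_variation x v (fst q) + hessian x (snd q))) (at (x, v))"
proof -
  have "((\<lambda>p. ((n i \<bullet> snd p) * inverse (slack i (fst p))) *\<^sub>R n i) has_derivative
      (\<lambda>q. ((n i \<bullet> snd q) * inverse (slack i x)
        - (n i \<bullet> v) * (n i \<bullet> fst q) * (inverse (slack i x) * inverse (slack i x))) *\<^sub>R n i)) (at (x, v))"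
    if "i \<in> I" for i
  proof (rule has_derivative_scaleR_left)
    have "((\<lambda>p. slack i (fst p)) has_derivative (\<lambda>q. n i \<bullet> fst q)) (at (x, v))"
      unfolding slack_def by (auto intro!: derivative_eq_intros)
    from Deriv.has_derivative_inverse[OF _ this] slack_pos[OF assms that]
    have inv: "((\<lambda>p. inverse (slack i (fst p))) has_derivative
        (\<lambda>q. - (inverse (slack i x) * (n i \<bullet> fst q) * inverse (slack i x)))) (at (x, v))"
      by simp
    have inner: "((\<lambda>p. n i \<bullet> snd p) has_derivative (\<lambda>q. n i \<bullet> snd q)) (at (x, v))"
      by (auto intro!: derivative_eq_intros)
    show "((\<lambda>p. (n i \<bullet> snd p) * inverse (slack i (fst p))) has_derivative
        (\<lambda>q. (n i \<bullet> snd q) * inverse (slack i x)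
          - (n i \<bullet> v) * (n i \<bullet> fst q) * (inverse (slack i x) * inverse (slack i x)))) (at (x, v))"
      by (rule has_derivative_eq_rhs[OF has_derivative_mult[OF inner inv]]) (simp add: fun_eq_iff mult_ac)
  qed
  from has_derivative_sum[of I, OF this] show ?thesis
    unfolding hessian_def hessian_variation_def
    by (simp add: scaleR_left_diff_distrib sum_subtractf)
qed

text \<open>Differentiability of \<open>y \<mapsto> solution_derivative y w\<close> is obtained from the inverse function theorem, applied
to the tangent map \<open>(x, v) \<mapsto> (log_gradient x, hessian x v)\<close>: its inverse is
\<open>(y, w) \<mapsto> (solution y, solution_derivative y w)\<close>.\<close>

lemma solution_derivative_has_derivative:
  "((\<lambda>y. solution_derivative y w) has_derivative
     (\<lambda>z. solution_derivative y
        (- hessian_variation (solution y) (solution_derivative y w) (solution_derivative y z)))) (at y)"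
proof -
  define T where "T = (\<lambda>(x, v). (log_gradient x, hessian x v))"
  define G where "G = (\<lambda>(y, w). (solution y, solution_derivative y w))"
  let ?R = "solution_derivative y" and ?x = "solution y" and ?v = "solution_derivative y w"
  let ?T' = "\<lambda>(d, e). (hessian ?x d, hessian_variation ?x ?v d + hessian ?x e)"
  let ?G' = "\<lambda>(z, e). (?R z, ?R (e - hessian_variation ?x ?v (?R z)))"
  have derT: "(T has_derivative (\<lambda>(d, e). (hessian x d, hessian_variation x v d + hessian x e))) (at (x, v))"
    if "x \<in> interior P" for x v
  proof -
    have "((\<lambda>p. log_gradient (fst p)) has_derivative (\<lambda>p. hessian x (fst p))) (at (x, v))"
      by (rule has_derivative_compose[OF has_derivative_fst[OF has_derivative_ident]])
        (simp add: log_gradient_has_derivative that)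
    from has_derivative_Pair[OF this hessian_has_derivative[OF that, of v]] show ?thesis
      by (simp add: T_def case_prod_unfold)
  qed
  have "(G has_derivative ?G') (at (y, w))"
  proof (rule has_derivative_inverse_strong_x)
    show "open (interior P \<times> (UNIV :: 'a set))"
      by (simp add: open_Times)
    show "G (y, w) \<in> interior P \<times> UNIV"
      by (simp add: G_def solution)
    show "continuous_on (interior P \<times> UNIV) T"
      using has_derivative_continuous[OF derT] by (force intro!: continuous_at_imp_continuous_on)
    show "G (T p) = p" if "p \<in> interior P \<times> UNIV" for p
      using that solution_derivative_hessian[of "log_gradient (fst p)"]
      by (auto simp: G_def T_def solution_log_gradient)
    show "(T has_derivative ?T') (at (G (y, w)))"
      using derT[OF solution(1)] by (simp add: G_def)
    show "?T' \<circ> ?G' = id"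
      by (auto simp: hessian_solution_derivative)
    show "T (G (y, w)) = (y, w)"
      by (simp add: T_def G_def solution hessian_solution_derivative)
  qed
  moreover have "((\<lambda>y. (y, w)) has_derivative (\<lambda>z. (z, 0))) (at y)"
    by (intro derivative_intros)
  ultimately have "((\<lambda>y. G (y, w)) has_derivative (\<lambda>z. ?G' (z, 0))) (at y)"
    using has_derivative_compose by blast
  then have "((\<lambda>y. snd (G (y, w))) has_derivative (\<lambda>z. snd (?G' (z, 0)))) (at y)"
    by (rule has_derivative_snd)
  then show ?thesis
    by (simp add: G_def)
qed

text \<open>The functions \<open>y \<mapsto> solution_derivative y w\<close> and \<open>y \<mapsto> 1 / slack i (solution y)\<close> form a system closed under
differentiation: all their directional derivatives are polynomials in functions of the system. Hence
regularity of order \<open>k\<close> for the whole system implies order \<open>k + 1\<close>.\<close>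

lemma Ck_on_solution: "Ck_on k UNIV solution"
proof -
  let ?q = "\<lambda>i y. inverse (slack i (solution y))"
  have "(\<forall>w. Ck_on k UNIV (\<lambda>y. solution_derivative y w)) \<and> (\<forall>i\<in>I. Ck_on k UNIV (?q i))" for k
  proof (induction k)
    case 0
    have "continuous_on UNIV (\<lambda>y. solution_derivative y w)" for w
      by (rule has_derivative_continuous_on[OF solution_derivative_has_derivative])
    moreover have "continuous_on UNIV (\<lambda>y. slack i (solution y))" for i
      unfolding slack_def
      by (intro continuous_intros has_derivative_continuous_on[OF solution_has_derivative])
    moreover have "slack i (solution y) \<noteq> 0" if "i \<in> I" for i y
      using slack_pos[OF solution(1) that] by (metis less_irrefl)
    ultimately show ?case
      by (auto intro!: continuous_on_inverse)
  next
    case (Suc k)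
    then have R: "Ck_on k UNIV (\<lambda>y. solution_derivative y w)" and q: "i \<in> I \<Longrightarrow> Ck_on k UNIV (?q i)" for w i
      by auto
    have nR: "Ck_on k UNIV (\<lambda>y. n i \<bullet> solution_derivative y w)" for i w
      by (intro Ck_on_bounded_linear_image[OF bounded_linear_inner_right] R) simp
    note mult = Ck_on_bilinear[OF bounded_bilinear_mult open_UNIV]
    note scale = Ck_on_bilinear[OF bounded_bilinear_scaleR open_UNIV]
    have "Ck_on (Suc k) UNIV (\<lambda>y. solution_derivative y w)" for w
    proof (rule Ck_on_SucI[OF open_UNIV])
      show "((\<lambda>y. solution_derivative y w) has_derivative
          (\<lambda>z. \<Sum>i\<in>I. ((n i \<bullet> solution_derivative y w) * (n i \<bullet> solution_derivative y z)
             * (?q i y * ?q i y)) *\<^sub>R solution_derivative y (n i))) (at y)" for y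
        using solution_derivative_has_derivative[of w y]
        by (simp add: hessian_variation_def linear_sum[OF linear_solution_derivative]
            linear_cmul[OF linear_solution_derivative])
      show "Ck_on k UNIV (\<lambda>y. \<Sum>i\<in>I. ((n i \<bullet> solution_derivative y w) * (n i \<bullet> solution_derivative y z)
             * (?q i y * ?q i y)) *\<^sub>R solution_derivative y (n i))" for z
        by (intro Ck_on_sum scale mult nR q R open_UNIV)
    qed
    moreover have "Ck_on (Suc k) UNIV (?q i)" if i: "i \<in> I" for i
    proof (rule Ck_on_SucI[OF open_UNIV])
      show "(?q i has_derivative (\<lambda>z. (- 1) *\<^sub>R ((n i \<bullet> solution_derivative y z) * (?q i y * ?q i y)))) (at y)" for y
        unfolding slack_def using slack_pos[OF solution(1)[of y] i]
        by (auto intro!: derivative_eq_intros solution_has_derivative simp: slack_def algebra_simps)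
      show "Ck_on k UNIV (\<lambda>y. (- 1) *\<^sub>R ((n i \<bullet> solution_derivative y z) * (?q i y * ?q i y)))" for z
        by (intro scale mult nR q i Ck_on_const open_UNIV)
    qed
    ultimately show ?case
      by blast
  qed
  then have "Ck_on (Suc k) UNIV solution"
    by (intro Ck_on_SucI[OF open_UNIV solution_has_derivative]) auto
  then show ?thesis
    by (rule Ck_on_SucD)
qed

lemma Ck_on_log_gradient: "Ck_on k (interior P) log_gradient"
proof -
  have "Ck_on k (interior P) (\<lambda>x. ln (slack i x))" if "i \<in> I" for i
    unfolding slack_def
    by (rule Ck_on_ln_affine[OF open_interior]) (use slack_pos that in \<open>simp add: slack_def\<close>)
  then show ?thesis
    unfolding log_gradient_def[abs_def]
    by (intro Ck_on_sum[OF open_interior] Ck_on_bilinear[OF bounded_bilinear_scaleR open_interior]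
        Ck_on_const open_interior)
qed

end

section \<open>Transport to the dual space\<close>

text \<open>The inverse of \<^const>\<open>blinfun_inner_right\<close>, which identifies the Euclidean space with its dual.\<close>

definition riesz_vector :: "('a::euclidean_space \<Rightarrow>\<^sub>L real) \<Rightarrow> 'a" where
  "riesz_vector \<phi> = (\<Sum>b\<in>Basis. blinfun_apply \<phi> b *\<^sub>R b)"

lemma riesz_vector_inner: "riesz_vector \<phi> \<bullet> v = blinfun_apply \<phi> v"
proof -
  have "blinfun_apply \<phi> v = blinfun_apply \<phi> (\<Sum>b\<in>Basis. (v \<bullet> b) *\<^sub>R b)"
    by (simp add: euclidean_representation)
  also have "\<dots> = (\<Sum>b\<in>Basis. blinfun_apply \<phi> b * (b \<bullet> v))"
    unfolding blinfun.sum_right blinfun.scaleR_right by (simp add: inner_commute[of v] mult.commute)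
  also have "\<dots> = riesz_vector \<phi> \<bullet> v"
    unfolding riesz_vector_def inner_sum_left by simp
  finally show ?thesis
    by (rule sym)
qed

lemma blinfun_inner_right_riesz_vector: "blinfun_inner_right (riesz_vector \<phi>) = \<phi>"
  by (rule blinfun_eqI) (simp add: riesz_vector_inner)

lemma riesz_vector_blinfun_inner_right: "riesz_vector (blinfun_inner_right w) = w"
  by (rule vector_eq_rdot[THEN iffD1]) (simp add: riesz_vector_inner)

lemma bounded_linear_riesz_vector: "bounded_linear riesz_vector"
  unfolding riesz_vector_def[abs_def]
  by (rule bounded_linear_sum, rule bounded_linear_compose[OF bounded_linear_scaleR_left blinfun.bounded_linear_left])

lemma is_norm_blinfun_inner_right:
  fixes N :: "('a::euclidean_space \<Rightarrow>\<^sub>L real) \<Rightarrow> real"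
  assumes "is_norm N"
  shows "is_norm (\<lambda>w. N (blinfun_inner_right w))"
proof -
  have "blinfun_inner_right w = 0 \<longleftrightarrow> w = 0" for w :: 'a
    by (metis riesz_vector_blinfun_inner_right linear_0 bounded_linear.linear bounded_linear_blinfun_inner_right)
  then show ?thesis
    using assms unfolding is_norm_def
    by (simp add: linear_add linear_cmul bounded_linear.linear bounded_linear_blinfun_inner_right)
qed

context bounded_polyhedron
begin

lemma blinfun_log_gradient:
  "blinfun_inner_right (log_gradient x) = (\<Sum>i\<in>I. ln (slack i x) *\<^sub>R blinfun_inner_right (n i))"
  by (simp add: log_gradient_def linear_sum linear_cmul bounded_linear.linear
      bounded_linear_blinfun_inner_right)

lemma diffeomorphism_log_gradient:
  "diffeomorphism (interior P) UNIV (\<lambda>x. blinfun_inner_right (log_gradient x))"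
proof -
  let ?\<Phi> = "\<lambda>x. blinfun_inner_right (log_gradient x) :: 'a \<Rightarrow>\<^sub>L real"
  have bij: "bij_betw ?\<Phi> (interior P) UNIV"
    by (rule bij_betw_byWitness[where f' = "\<lambda>\<phi>. solution (riesz_vector \<phi>)"])
      (auto simp: solution solution_log_gradient riesz_vector_blinfun_inner_right blinfun_inner_right_riesz_vector)
  then have "inv_into (interior P) ?\<Phi> \<phi> = solution (riesz_vector \<phi>)" for \<phi>
    by (intro inv_into_f_eq)
      (auto simp: bij_betw_def solution blinfun_inner_right_riesz_vector)
  then have "inv_into (interior P) ?\<Phi> = (\<lambda>\<phi>. solution (riesz_vector \<phi>))" ..
  moreover have "Ck_on k UNIV (\<lambda>\<phi>. solution (riesz_vector \<phi>))" for k
    by (rule Ck_on_linear_precompose[OF bounded_linear_riesz_vector _ open_UNIV _ Ck_on_solution]) auto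
  moreover have "Ck_on k (interior P) ?\<Phi>" for k
    by (rule Ck_on_bounded_linear_image[OF bounded_linear_blinfun_inner_right open_interior Ck_on_log_gradient])
  ultimately show ?thesis
    using bij by (simp add: diffeomorphism_def smooth_on_def)
qed

text \<open>Both inequalities compare with the family \<open>g i = ln (slack i x) - ln (slack i y)\<close>. Above, the image difference
is the combination of the \<open>n i\<close> with coefficients \<open>g i\<close>, each at most twice the distance; below,
cancellation is excluded by sign compatibility.\<close>

lemma bilipschitz_log_gradient:
  assumes "is_norm N"
  shows "bilipschitz_on (interior P) (hilbert_dist P) N (\<lambda>x. blinfun_inner_right (log_gradient x))"
proof -
  define M where "M w = N (blinfun_inner_right w)" for w
  have M: "is_norm M"
    unfolding M_def by (rule is_norm_blinfun_inner_right[OF assms])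
  then have M_nonneg: "M w \<ge> 0" for w
    by (simp add: is_norm_def)
  obtain a where a: "a > 0" "\<And>w. a * norm w \<le> M w"
    using norm_equivalence_lower[OF M] by metis
  obtain k where k: "k > 0" "\<And>x y. x \<in> interior P \<Longrightarrow> y \<in> interior P \<Longrightarrow>
     k * (\<Sum>i\<in>I. \<bar>ln (slack i x) - ln (slack i y)\<bar>) \<le> norm (log_gradient x - log_gradient y)"
    using log_gradient_lower_bound by blast
  define U where "U = 2 * (\<Sum>i\<in>I. M (n i))"
  \<comment> \<open>The three terms make \<open>L\<close> at least \<open>1\<close>, the upper constant and the inverse of the lower constant.\<close>
  define L where "L = 1 + U + inverse (a * k)"
  have "U \<ge> 0"
    by (simp add: U_def sum_nonneg M_nonneg)
  then have L: "L \<ge> 1" "U \<le> L" "inverse (a * k) \<le> L"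
    using a(1) k(1) by (simp_all add: L_def)
  then have "inverse L \<le> a * k"
    using a(1) k(1) by (metis inverse_inverse_eq le_imp_inverse_le mult_pos_pos positive_imp_inverse_positive)
  have "inverse L * hilbert_dist P x y \<le> M (log_gradient x - log_gradient y) \<and>
      M (log_gradient x - log_gradient y) \<le> L * hilbert_dist P x y"
    if xy: "x \<in> interior P" "y \<in> interior P" for x y
  proof
    let ?g = "\<lambda>i. ln (slack i x) - ln (slack i y)" and ?d = "hilbert_dist P x y"
    note bounds = hilbert_dist_bounds[OF xy]
    obtain i where "i \<in> I"
      using I_nonempty by blast
    then have "?d \<ge> 0"
      using bounds(1)[of i] by linarith
    have "inverse L * ?d \<le> (a * k) * ?d"
      using \<open>inverse L \<le> a * k\<close> \<open>?d \<ge> 0\<close> by (rule mult_right_mono)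
    also have "\<dots> \<le> a * (k * (\<Sum>i\<in>I. \<bar>?g i\<bar>))"
      using bounds(2) a(1) k(1) by simp
    also have "\<dots> \<le> a * norm (log_gradient x - log_gradient y)"
      using k(2)[OF xy] a(1) by simp
    also have "\<dots> \<le> M (log_gradient x - log_gradient y)"
      by (rule a(2))
    finally show "inverse L * ?d \<le> M (log_gradient x - log_gradient y)" .
    have "M (log_gradient x - log_gradient y) = M (\<Sum>i\<in>I. ?g i *\<^sub>R n i)"
      by (simp add: log_gradient_def scaleR_left_diff_distrib sum_subtractf)
    also have "\<dots> \<le> (\<Sum>i\<in>I. \<bar>?g i\<bar> * M (n i))"
      by (rule is_norm_sum_scaleR_le[OF M])
    also have "\<dots> \<le> (\<Sum>i\<in>I. 2 * ?d * M (n i))"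
      by (intro sum_mono mult_right_mono bounds(1) M_nonneg)
    also have "\<dots> = U * ?d"
      by (simp add: U_def sum_distrib_left sum_distrib_right mult_ac)
    also have "\<dots> \<le> L * ?d"
      using L(2) \<open>?d \<ge> 0\<close> by (rule mult_right_mono)
    finally show "M (log_gradient x - log_gradient y) \<le> L * ?d" .
  qed
  moreover have "N (blinfun_inner_right (log_gradient x) - blinfun_inner_right (log_gradient y))
      = M (log_gradient x - log_gradient y)" for x y
    by (simp add: M_def linear_diff bounded_linear.linear bounded_linear_blinfun_inner_right)
  ultimately show ?thesis
    using L(1) unfolding bilipschitz_on_def by auto
qed

end

theorem theorem1p1:
  fixes P :: "'a::euclidean_space set"
    and f :: "nat \<Rightarrow> 'a \<Rightarrow> real"
    and m :: nat
    and N :: "('a \<Rightarrow>\<^sub>L real) \<Rightarrow> real"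
  assumes "polytope P"
    and "interior P \<noteq> {}"
    and "\<And>i. i \<in> {1..m} \<Longrightarrow> affine_function (f i)"
    and "\<And>i. i \<in> {1..m} \<Longrightarrow> \<not> f i constant_on UNIV"
    and "P = {x. \<forall>i\<in>{1..m}. 0 \<le> f i x}"
    and "is_norm N"
  shows "diffeomorphism (interior P) UNIV (log_differential_map m f) \<and>
    bilipschitz_on (interior P) (hilbert_dist P) N (log_differential_map m f)"
proof -
  define n where "n i = riesz_vector (differential (f i))" for i
  define c where "c i = f i 0" for i
  have f: "f i x = n i \<bullet> x + c i" if "i \<in> {1..m}" for i x
    using differential_apply[OF assms(3)[OF that], of x] by (simp add: n_def c_def riesz_vector_inner)
  interpret bounded_polyhedron "{1..m}" n c P
  proof
    show "n i \<noteq> 0" if "i \<in> {1..m}" for i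
    proof
      assume "n i = 0"
      then have "f i x = c i" for x
        using f[OF that] by simp
      then show False
        using assms(4)[OF that] unfolding constant_on_def by blast
    qed
    show "P = {x. \<forall>i\<in>{1..m}. 0 \<le> n i \<bullet> x + c i}"
      unfolding assms(5) by (rule Collect_cong) (use f in simp)
  qed (use assms polytope_imp_bounded in auto)
  have "log_differential_map m f x = blinfun_inner_right (log_gradient x)" for x
  proof -
    have "blinfun_inner_right (log_gradient x) = log_differential_map m f x"
      unfolding log_differential_map_def blinfun_log_gradient
      by (rule sum.cong) (simp_all add: slack_def f n_def blinfun_inner_right_riesz_vector)
    then show ?thesis
      by (rule sym)
  qed
  then have "log_differential_map m f = (\<lambda>x. blinfun_inner_right (log_gradient x))" ..
  then show ?thesis
    using diffeomorphism_log_gradient bilipschitz_log_gradient[OF assms(6)] by metis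
qed

end
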